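(* Let $\boldsymbol{\Omega}=(\Omega_k(n))_{k,n\in\mathbb{N}}$ be a system of weights, i.e. a family of real numbers with $0<\Omega_{k-1}(n)\le \Omega_k(n)$ for all $k\ge 1$ and $n\in\mathbb{N}$, and let $(n_a)_{a\in\mathbb{N}}\subset\mathbb{P}$ be a sequence of indices. (a) Boundedness. Assume that $$\sup_{a\in\mathbb{N}}\sum_{k=0}^{|n_a|}\bigl|\varepsilon_{k-1}(n_a)-\varepsilon_k(n_a)\bigr|\,\Omega_k(n_a)<\infty$$ (with $\varepsilon_{-1}(n):=0$) and $$\sup_{a\in\mathbb{N}}\Omega_{|n_a|}(n_a)<\infty .$$ Then the maximal operator $W_C(\boldsymbol{\Omega},\{n_a\})$ is of weak type $(1,1)$, that is, $$\|W_C(\boldsymbol{\Omega},\{n_a\})\|_{L_1(\mathbb{I})\to L_{1,\infty}(\mathbb{I})}<\infty .$$ (b) Divergence. If there exists a sequence of divergence with respect to $(\Omega_k(n))$, then the full maximal operator $W_C(\boldsymbol{\Omega})$ is not of weak type $(1,1)$, that is, $$\|W_C(\boldsymbol{\Omega})\|_{L_1(\mathbb{I})\to L_{1,\infty}(\mathbb{I})}=\infty .$$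
   Context: Notation: $\mathbb{P}=\{1,2,\dots\}$, $\mathbb{N}=\mathbb{P}\cup\{0\}$, $\mathbb{I}=[0,1)$ with Lebesgue measure $|\cdot|$. For $n\in\mathbb{N}$ write $n=\sum_{j\ge0}\varepsilon_j(n)2^j$ with $\varepsilon_j(n)\in\{0,1\}$; for $n\in\mathbb{P}$, $|n|:=\max\{s:\varepsilon_s(n)=1\}$. Each $x\in\mathbb{I}$ is written $x=\sum_{j\ge0}x_j2^{-(j+1)}$, $x_j\in\{0,1\}$ (terminating expansion for dyadic rationals). The Rademacher functions are $r_k(x)=(-1)^{x_k}$ and the Walsh--Paley functions are $w_n=\prod_{k\ge0}r_k^{\varepsilon_k(n)}$. $E_k$ denotes conditional expectation with respect to the $\sigma$-algebra generated by the dyadic intervals of length $2^{-k}$ in $\mathbb{I}$, and $\mathcal{E}_kf:=E_{k+1}f-E_kf$. For $f\in L_1(\mathbb{I})$ put $$W_C(\boldsymbol{\Omega})f:=\sup_{n\in\mathbb{N}}\Bigl|\sum_{k=0}^\infty\varepsilon_k(n)\Omega_k(n)\,\mathcal{E}_k(fw_n)\Bigr|,\qquad W_C(\boldsymbol{\Omega},\{n_a\})f:=\sup_{a\in\mathbb{N}}\Bigl|\sum_{k=0}^\infty\varepsilon_k(n_a)\Omega_k(n_a)\,\mathcal{E}_k(fw_{n_a})\Bigr|$$ (the sums are finite). $\|g\|_1=\int_{\mathbb{I}}|g|$, $\|g\|_{1,\infty}=\sup_{\lambda>0}\lambda|\{|g|>\lambda\}|$, and for an operator $W$, $\|W\|_{L_1(\mathbb{I})\to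 L_{1,\infty}(\mathbb{I})}:=\sup\{\|Wf\|_{1,\infty}:\|f\|_1\le1\}$. A sequence $\gamma=(\gamma(n))_{n\in\mathbb{P}}$ of positive integers is a sequence of divergence with respect to $(\Omega_k(n))$ if (i) $\lim_{N\to\infty}\inf\{\gamma(n):n\in\mathbb{P},\,|n|\ge N\}=\infty$; and there is $N_0\ge1$ such that (ii) $\sup\{\gamma(n)/|n|: n\in\mathbb{P},\,|n|\ge N_0\}<1$, and (iii) there is a constant $c>0$ with $\Omega_{|n|-\gamma(n)}(n)\ge c$ for all $n\in\mathbb{P}$ with $|n|\ge N_0$. *)

theory Defs
  imports "HOL-Probability.Conditional_Expectation"
begin

section \<open>Binary digits of natural numbers and of points of the unit interval\<close>

definition eps :: "nat \<Rightarrow> nat \<Rightarrow> nat" where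
  "eps j n = of_bool (bit n j)"

(* meaningful for n > 0 only *)
definition order_of :: "nat \<Rightarrow> nat" where
  "order_of n = Max {s. eps s n = 1}"

abbreviation unit_interval :: "real measure" where
  "unit_interval \<equiv> lebesgue_on {0..<1}"

(* The j-th digit of x = sum_j x_j / 2^(j+1); the floor selects the terminating
   expansion at dyadic rationals (see digit_sums and digit_terminating). *)
definition digit :: "nat \<Rightarrow> real \<Rightarrow> nat" where
  "digit j x = nat (\<lfloor>x * 2 ^ (j + 1)\<rfloor> mod 2)"

lemma digit_partial_sum:
  assumes "0 \<le> x" "x < 1"
  shows "(\<Sum>j<n. real (digit j x) / 2 ^ (j + 1)) = real_of_int \<lfloor>x * 2 ^ n\<rfloor> / 2 ^ n"
proof (induction n)
  case 0
  have "\<lfloor>x\<rfloor> = 0"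
    using assms by linarith
  then show ?case by simp
next
  case (Suc n)
  define y where "y = x * 2 ^ n"
  have eq: "x * 2 ^ Suc n = 2 * y"
    by (simp add: y_def)
  have "\<lfloor>2 * y\<rfloor> div 2 = \<lfloor>y\<rfloor>"
    using floor_divide_real_eq_div[of 2 "2 * y"] by simp
  then have "\<lfloor>2 * y\<rfloor> = 2 * \<lfloor>y\<rfloor> + \<lfloor>2 * y\<rfloor> mod 2"
    using mult_div_mod_eq[of 2 "\<lfloor>2 * y\<rfloor>"] by simp
  moreover have "real (digit n x) = real_of_int (\<lfloor>2 * y\<rfloor> mod 2)"
    by (simp add: digit_def y_def mult_ac)
  ultimately have "real_of_int \<lfloor>2 * y\<rfloor> = 2 * real_of_int \<lfloor>y\<rfloor> + real (digit n x)"
    by linarith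
  then have "real_of_int \<lfloor>x * 2 ^ Suc n\<rfloor> / 2 ^ Suc n
      = real_of_int \<lfloor>y\<rfloor> / 2 ^ n + real (digit n x) / 2 ^ (n + 1)"
    unfolding eq by (simp add: add_divide_distrib)
  then show ?case
    using Suc unfolding y_def by simp
qed

lemma digit_sums:
  assumes "0 \<le> x" "x < 1"
  shows "(\<lambda>j. real (digit j x) / 2 ^ (j + 1)) sums x"
proof -
  have lim0: "(\<lambda>n. (1/2::real) ^ n) \<longlonglongrightarrow> 0"
    by (intro LIMSEQ_power_zero) simp
  have bounds: "x - (1/2) ^ n \<le> real_of_int \<lfloor>x * 2 ^ n\<rfloor> / 2 ^ n"
       "real_of_int \<lfloor>x * 2 ^ n\<rfloor> / 2 ^ n \<le> x" for n
  proof -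
    have "x * 2 ^ n - 1 \<le> real_of_int \<lfloor>x * 2 ^ n\<rfloor>" by linarith
    then have "(x * 2 ^ n - 1) / 2 ^ n \<le> real_of_int \<lfloor>x * 2 ^ n\<rfloor> / 2 ^ n"
      by (rule divide_right_mono) simp
    then show "x - (1/2) ^ n \<le> real_of_int \<lfloor>x * 2 ^ n\<rfloor> / 2 ^ n"
      by (simp add: diff_divide_distrib power_one_over)
    show "real_of_int \<lfloor>x * 2 ^ n\<rfloor> / 2 ^ n \<le> x"
      by (simp add: divide_le_eq)
  qed
  have lower: "(\<lambda>n. x - (1/2) ^ n) \<longlonglongrightarrow> x"
    using tendsto_diff[OF tendsto_const lim0, of x] by simp
  have "(\<lambda>n. real_of_int \<lfloor>x * 2 ^ n\<rfloor> / 2 ^ n) \<longlonglongrightarrow> x"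
    by (rule tendsto_sandwich[OF _ _ lower tendsto_const])
       (rule always_eventually, rule allI, rule bounds)+
  then show ?thesis
    unfolding sums_def digit_partial_sum[OF assms] .
qed

lemma digit_terminating:
  assumes "0 \<le> x" "x < 1"
  shows "\<exists>j\<ge>N. digit j x = 0"
proof (rule ccontr)
  assume *: "\<not> ?thesis"
  have one: "digit (j + N) x = 1" for j
  proof -
    have "digit (j + N) x \<noteq> 0"
      using * le_add2[of N j] by metis
    moreover have "digit (j + N) x < 2"
      unfolding digit_def using pos_mod_bound[of 2 "\<lfloor>x * 2 ^ (j + N + 1)\<rfloor>"] by linarith
    ultimately show ?thesis by linarith
  qed
  have "(\<lambda>j. real (digit (j + N) x) / 2 ^ (j + N + 1)) sums
      (x - (\<Sum>j<N. real (digit j x) / 2 ^ (j + 1)))"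
    using sums_split_initial_segment[OF digit_sums[OF assms], of N] by simp
  then have tail: "(\<lambda>j. 1 / 2 ^ (j + N + 1)) sums (x - real_of_int \<lfloor>x * 2 ^ N\<rfloor> / 2 ^ N)"
    by (simp only: digit_partial_sum[OF assms] one of_nat_1)
  have "(\<lambda>j. (1/2 :: real) ^ Suc j * (1 / 2 ^ N)) sums (1 * (1 / 2 ^ N))"
    by (intro sums_mult2 power_half_series)
  moreover have "(1/2 :: real) ^ Suc j * (1 / 2 ^ N) = 1 / 2 ^ (j + N + 1)" for j
    by (simp add: power_add power_one_over)
  ultimately have "(\<lambda>j. 1 / 2 ^ (j + N + 1)) sums (1 / 2 ^ N :: real)"
    by simp
  with tail have "x - real_of_int \<lfloor>x * 2 ^ N\<rfloor> / 2 ^ N = 1 / 2 ^ N"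
    by (rule sums_unique2)
  then have "x * 2 ^ N = real_of_int \<lfloor>x * 2 ^ N\<rfloor> + 1"
    by (simp add: field_simps)
  then show False by linarith
qed


section \<open>Walsh--Paley functions and dyadic conditional expectations\<close>

definition rademacher :: "nat \<Rightarrow> real \<Rightarrow> real" where
  "rademacher k x = (- 1) ^ digit k x"

(* only finitely many factors differ from 1 *)
definition walsh :: "nat \<Rightarrow> real \<Rightarrow> real" where
  "walsh n x = (\<Prod>k. rademacher k x ^ eps k n)"

definition dyadic_intervals :: "nat \<Rightarrow> real set set" where
  "dyadic_intervals k = {{real j / 2 ^ k ..< (real j + 1) / 2 ^ k} | j. j < 2 ^ k}"

definition dyadic_algebra :: "nat \<Rightarrow> real measure" where
  "dyadic_algebra k = sigma {0..<1} (dyadic_intervals k)"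

lemma subalgebra_dyadic_algebra: "subalgebra unit_interval (dyadic_algebra k)"
proof -
  have sub: "I \<subseteq> {0..<1}" if mem: "I \<in> dyadic_intervals k" for I
  proof -
    obtain j where j: "j < 2 ^ k" and I: "I = {real j / 2 ^ k ..< (real j + 1) / 2 ^ k}"
      using mem unfolding dyadic_intervals_def by blast
    from j have "Suc j \<le> 2 ^ k" by simp
    then have "real (Suc j) \<le> real (2 ^ k)" by (rule of_nat_mono)
    then have "(real j + 1) / 2 ^ k \<le> 1" by simp
    moreover have "0 \<le> real j / 2 ^ k" by simp
    ultimately show ?thesis unfolding I by auto
  qed
  have "I \<in> sets unit_interval" if "I \<in> dyadic_intervals k" for I
    using that sub[OF that] by (auto simp: dyadic_intervals_def sets_restrict_space_iff)
  then have "sigma_sets {0..<1} (dyadic_intervals k) \<subseteq> sets unit_interval"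
    using sets.sigma_sets_subset[of "dyadic_intervals k" unit_interval] by auto
  moreover have "dyadic_intervals k \<subseteq> Pow {0..<1}"
    using sub by auto
  ultimately show ?thesis
    by (simp add: subalgebra_def dyadic_algebra_def)
qed

(* A dyadic-algebra measurable function is constant on each dyadic interval of length 2^-k,
   and these have positive measure; hence real_cond_exp, in general determined only almost
   everywhere, is here determined at every point of [0,1). *)
definition E :: "nat \<Rightarrow> (real \<Rightarrow> real) \<Rightarrow> real \<Rightarrow> real" where
  "E k f = real_cond_exp unit_interval (dyadic_algebra k) f"

definition E_diff :: "nat \<Rightarrow> (real \<Rightarrow> real) \<Rightarrow> real \<Rightarrow> real" where
  "E_diff k f x = E (k + 1) f x - E k f x"


section \<open>Weights and the maximal operators\<close>

(* argument order: \<Omega> k n stands for \<Omega>_k(n) *)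
definition weights :: "(nat \<Rightarrow> nat \<Rightarrow> real) \<Rightarrow> bool" where
  "weights \<Omega> \<longleftrightarrow> (\<forall>n. \<forall>k\<ge>1. 0 < \<Omega> (k - 1) n \<and> \<Omega> (k - 1) n \<le> \<Omega> k n)"

(* the terms with k > order_of n vanish *)
definition weighted_sum :: "(nat \<Rightarrow> nat \<Rightarrow> real) \<Rightarrow> nat \<Rightarrow> (real \<Rightarrow> real) \<Rightarrow> real \<Rightarrow> real" where
  "weighted_sum \<Omega> n f x =
     (\<Sum>k. real (eps k n) * \<Omega> k n * E_diff k (\<lambda>y. f y * walsh n y) x)"

definition W_C :: "(nat \<Rightarrow> nat \<Rightarrow> real) \<Rightarrow> (real \<Rightarrow> real) \<Rightarrow> real \<Rightarrow> ennreal" where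
  "W_C \<Omega> f x = (SUP n. ennreal \<bar>weighted_sum \<Omega> n f x\<bar>)"

definition W_C_seq ::
  "(nat \<Rightarrow> nat \<Rightarrow> real) \<Rightarrow> (nat \<Rightarrow> nat) \<Rightarrow> (real \<Rightarrow> real) \<Rightarrow> real \<Rightarrow> ennreal" where
  "W_C_seq \<Omega> ns f x = (SUP a. ennreal \<bar>weighted_sum \<Omega> (ns a) f x\<bar>)"

(* The maximal functions are nonnegative and possibly infinite, hence ennreal-valued. *)
definition weak_L1_norm :: "(real \<Rightarrow> ennreal) \<Rightarrow> ennreal" where
  "weak_L1_norm g =
     (SUP t\<in>{0::real<..}. ennreal t * emeasure unit_interval {x \<in> {0..<1}. ennreal t < g x})"

definition weak_type_norm :: "((real \<Rightarrow> real) \<Rightarrow> real \<Rightarrow> ennreal) \<Rightarrow> ennreal" where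
  "weak_type_norm W =
     (SUP f\<in>{f. integrable unit_interval f \<and> (\<integral>x. \<bar>f x\<bar> \<partial>unit_interval) \<le> 1}.
        weak_L1_norm (W f))"

(* The supremum is taken in ereal, where it exists unconditionally. By its bound,
   \<gamma> n < order_of n, so the truncated subtraction in the last condition is the true one. *)
definition divergence_sequence :: "(nat \<Rightarrow> nat \<Rightarrow> real) \<Rightarrow> (nat \<Rightarrow> nat) \<Rightarrow> bool" where
  "divergence_sequence \<Omega> \<gamma> \<longleftrightarrow>
     (\<forall>n>0. \<gamma> n > 0) \<and>
     filterlim (\<lambda>N. INF n\<in>{n. 0 < n \<and> N \<le> order_of n}. \<gamma> n) at_top sequentially \<and>
     (\<exists>N0\<ge>1.
        (SUP n\<in>{n. 0 < n \<and> N0 \<le> order_of n}. ereal (real (\<gamma> n) / real (order_of n))) < 1 \<and>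
        (\<exists>c>0. \<forall>n. 0 < n \<and> N0 \<le> order_of n \<longrightarrow> c \<le> \<Omega> (order_of n - \<gamma> n) n))"

end

theory Submission
  imports Defs
begin

text \<open>
  Boundedness. Summation by parts turns the weighted sum of martingale differences of \<open>f w\<^sub>n\<close>
  into a combination of the conditional expectations \<open>E\<^sub>k (f w\<^sub>n)\<close>. Because the weights increase, the
  coefficients have total size at most twice the weighted digit variation of \<open>n\<close> plus twice the
  top weight (\<open>abel_summation_bound\<close>). Because \<open>\<bar>w\<^sub>n\<bar> = 1\<close>, each of these expectations is at most the
  dyadic maximal function of \<open>f\<close>, whatever \<open>n\<close> is. So the maximal operator is dominated by a multiple of the
  dyadic maximal function, which is of weak type (1,1) (\<open>dyadic_maximal_inequality\<close>).

  Divergence. This is a construction in the style of Kolmogorov. The test function is a sum of \<open>2^L\<close> equal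
  point masses, smeared out at a scale too fine to be noticed. Up to the sign \<open>w\<^sub>n(t)\<close>, the mass at \<open>t\<close> acts
  at \<open>x\<close> through a kernel that depends only on the position \<open>J\<close> of the first digit in which \<open>x\<close> and \<open>t\<close>
  differ. If the digits of \<open>n\<close> alternate near \<open>J\<close> and the weights there are bounded below, this kernel
  is at least a constant times \<open>2^J\<close> in modulus, and its sign depends only on the digit of \<open>n\<close> at \<open>J\<close>,
  because the weights increase (\<open>walsh_kernel_sign\<close>). The masses carry private marker digits, so the
  higher digits of \<open>n\<close> can be chosen, depending on \<open>x\<close>, to correct all signs at once
  (\<open>exists_index_with_walsh_signs\<close>). What remains is an average of \<open>2^J\<close> over the masses, and each of
  the \<open>L + 1\<close> scales contributes equally to it (\<open>sum_first_difference\<close>); so it grows linearly in \<open>L\<close>.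

  All this uses only about \<open>2^L\<close> digits of \<open>n\<close> below the top one. A sequence of divergence guarantees weights
  bounded below on any such number of top digits, provided the order of \<open>n\<close> is large
  (\<open>divergence_sequence_large_weights\<close>). The digits of \<open>n\<close> below position \<open>a\<close> are set to zero and
  the construction takes place in \<open>[0, 2^(-a))\<close>, which is harmless because weak type (1,1) is invariant
  under scaling.
\<close>


section \<open>Finite forms of Walsh functions and weighted sums\<close>

lemma eps_le_1: "eps k n \<le> 1" by (simp add: eps_def)

text \<open>
  Together with finite support of the digits this makes \<^const>\<open>order_of\<close> a genuine maximum and
  every sum and product over digits finite.
\<close>

lemma finite_eps: "finite {s. eps s n = 1}"
proof (rule finite_subset)
  show "{s. eps s n = 1} \<subseteq> {..n}"
  proof
    fix s assume "s \<in> {s. eps s n = 1}"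
    then have "odd (n div 2 ^ s)"
      by (auto simp: eps_def bit_iff_odd split: if_splits)
    then have "n div 2 ^ s \<noteq> 0" by (metis even_zero)
    then have "2 ^ s \<le> n" by (simp add: div_eq_0_iff)
    then show "s \<in> {..n}" using less_exp[of s] order.strict_trans2[of s "2 ^ s" n] by (simp only: atMost_iff)
  qed
qed auto

lemma eps_above_order:
  assumes "order_of n < k"
  shows "eps k n = 0"
proof -
  have "eps k n \<noteq> 1"
    using Max_ge[OF finite_eps, of k n] assms by (auto simp: order_of_def)
  then show ?thesis using eps_le_1[of k n] by linarith
qed

lemma walsh_eq_prod:
  assumes "\<And>k. N \<le> k \<Longrightarrow> eps k n = 0"
  shows "walsh n x = (\<Prod>k<N. rademacher k x ^ eps k n)"
  unfolding walsh_def by (rule prodinf_finite) (auto simp: assms)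

lemma weighted_sum_eq_sum:
  assumes "\<And>k. N \<le> k \<Longrightarrow> eps k n = 0"
  shows "weighted_sum \<Omega> n f x
    = (\<Sum>k<N. real (eps k n) * \<Omega> k n * E_diff k (\<lambda>y. f y * walsh n y) x)"
  unfolding weighted_sum_def by (rule suminf_finite) (auto simp: assms)

lemma measurable_walsh [measurable]: "walsh n \<in> borel_measurable unit_interval"
proof -
  have "digit k \<in> measurable borel (count_space UNIV)" for k
    unfolding digit_def by measurable
  then have "rademacher k \<in> borel_measurable borel" for k
    unfolding rademacher_def by measurable
  then have "rademacher k \<in> borel_measurable lebesgue" for k
    by (intro measurable_completion) simp
  moreover have "walsh n = (\<lambda>x. \<Prod>k<Suc (order_of n). rademacher k x ^ eps k n)"
    by (rule ext, rule walsh_eq_prod) (simp add: eps_above_order)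
  ultimately show ?thesis
    by (auto intro!: measurable_restrict_space1 borel_measurable_prod borel_measurable_power)
qed

lemma abs_walsh [simp]: "\<bar>walsh n x\<bar> = 1"
proof -
  have "walsh n x = (\<Prod>k<Suc (order_of n). rademacher k x ^ eps k n)"
    by (rule walsh_eq_prod) (simp add: eps_above_order)
  then show ?thesis
    by (simp only: abs_prod power_abs rademacher_def) simp
qed

lemma integrable_walsh_mult:
  assumes "integrable unit_interval f"
  shows "integrable unit_interval (\<lambda>x. f x * walsh n x)"
proof (rule Bochner_Integration.integrable_bound[OF assms])
  show "(\<lambda>x. f x * walsh n x) \<in> borel_measurable unit_interval"
    using assms by measurable
qed (simp add: abs_mult)

section \<open>The dyadic maximal inequality\<close>

interpretation unit: prob_space unit_interval
  by (rule prob_spaceI) (simp add: emeasure_restrict_space)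

interpretation dyadic: sigma_finite_subalgebra unit_interval "dyadic_algebra k" for k
  by (intro finite_measure_subalgebra_is_sigma_finite finite_measure_subalgebra.intro
      finite_measure_subalgebra_axioms.intro unit.finite_measure_axioms subalgebra_dyadic_algebra)

lemma dyadic_algebra_space [simp]: "space (dyadic_algebra k) = {0..<1}"
  using subalgebra_dyadic_algebra[of k] by (simp add: subalgebra_def)

lemma measurable_E [measurable]: "E k f \<in> borel_measurable unit_interval"
  unfolding E_def by measurable

lemma dyadic_intervals_subset: "dyadic_intervals k \<subseteq> Pow {0..<1}"
proof
  fix I assume "I \<in> dyadic_intervals k"
  then obtain j where j: "j < 2 ^ k" and I: "I = {real j / 2 ^ k ..< (real j + 1) / 2 ^ k}"
    unfolding dyadic_intervals_def by blast
  have "real (Suc j) \<le> real (2 ^ k)" using j by (intro of_nat_mono) simp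
  then have "(real j + 1) / 2 ^ k \<le> 1" by simp
  moreover have "0 \<le> real j / 2 ^ k" by simp
  ultimately show "I \<in> Pow {0..<1}"
    unfolding I by auto
qed

lemma sets_dyadic_algebra: "sets (dyadic_algebra k) = sigma_sets {0..<1} (dyadic_intervals k)"
  using dyadic_intervals_subset by (simp add: dyadic_algebra_def)

lemma dyadic_algebra_Suc: "sets (dyadic_algebra k) \<subseteq> sets (dyadic_algebra (Suc k))"
proof -
  have "I \<in> sets (dyadic_algebra (Suc k))" if I: "I \<in> dyadic_intervals k" for I
  proof -
    obtain j where j: "j < 2 ^ k" and I: "I = {real j / 2 ^ k ..< (real j + 1) / 2 ^ k}"
      using I unfolding dyadic_intervals_def by blast
    let ?D = "\<lambda>i. {real i / 2 ^ Suc k ..< (real i + 1) / 2 ^ Suc k}"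
    have "?D i \<in> sets (dyadic_algebra (Suc k))" if "i < 2 ^ Suc k" for i
      unfolding sets_dyadic_algebra dyadic_intervals_def using that by (blast intro: sigma_sets.Basic)
    from this[of "2 * j"] this[of "2 * j + 1"]
    have "?D (2 * j) \<union> ?D (2 * j + 1) \<in> sets (dyadic_algebra (Suc k))"
      using j by (intro sets.Un) simp_all
    moreover have "?D (2 * j) \<union> ?D (2 * j + 1) = I"
      unfolding I by (auto simp: field_simps)
    ultimately show ?thesis by simp
  qed
  then show ?thesis
    unfolding sets_dyadic_algebra[of k] using sets.sigma_sets_subset[of "dyadic_intervals k" "dyadic_algebra (Suc k)"]
    by auto
qed

lemma dyadic_algebra_mono: "j \<le> k \<Longrightarrow> sets (dyadic_algebra j) \<subseteq> sets (dyadic_algebra k)"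
  by (rule lift_Suc_mono_le[of "\<lambda>k. sets (dyadic_algebra k)"]) (rule dyadic_algebra_Suc)

lemma E_level_set: "{x \<in> {0..<1}. t < E k f x} \<in> sets (dyadic_algebra k)"
proof -
  have "E k f \<in> borel_measurable (dyadic_algebra k)"
    unfolding E_def by (rule borel_measurable_cond_exp)
  then have "{x \<in> space (dyadic_algebra k). t < E k f x} \<in> sets (dyadic_algebra k)"
    by measurable
  then show ?thesis by simp
qed

text \<open>
  The weak type (1,1) inequality of Doob for the dyadic martingale. The level set is split according to
  the first level \<open>k\<close> at which the average exceeds \<open>t\<close>. The part belonging to \<open>k\<close> is an event of the
  \<open>k\<close>-th algebra, so on it \<open>f\<close> and its conditional expectation, which is larger than \<open>t\<close> there, have
  the same integral.
\<close>

lemma dyadic_maximal_inequality: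
  assumes f: "integrable unit_interval f" "\<And>x. 0 \<le> f x" and t: "0 < t"
  shows "t * measure unit_interval {x \<in> {0..<1}. \<exists>k. t < E k f x} \<le> (\<integral>x. f x \<partial>unit_interval)"
proof -
  define A where "A k = {x \<in> {0..<1}. t < E k f x} - (\<Union>j<k. {x \<in> {0..<1}. t < E j f x})" for k
  have A_dyadic: "A k \<in> sets (dyadic_algebra k)" for k
  proof -
    have "{x \<in> {0..<1}. t < E j f x} \<in> sets (dyadic_algebra k)" if "j < k" for j
      using E_level_set dyadic_algebra_mono that less_imp_le by blast
    then show ?thesis
      unfolding A_def by (intro sets.Diff E_level_set sets.finite_UN) auto
  qed
  then have A [measurable]: "A k \<in> sets unit_interval" for k
    using subalgebra_dyadic_algebra[of k] unfolding subalgebra_def by blast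
  have disj: "disjoint_family A"
    unfolding disjoint_family_on_def
  proof (intro ballI impI)
    fix m n :: nat assume "m \<noteq> n"
    then show "A m \<inter> A n = {}"
      by (cases m n rule: linorder_cases) (auto simp: A_def)
  qed
  have Un: "{x \<in> {0..<1}. \<exists>k. t < E k f x} = (\<Union>k. A k)"
  proof (intro equalityI subsetI)
    fix x assume "x \<in> {x \<in> {0..<1}. \<exists>k. t < E k f x}"
    then have x: "x \<in> {0..<1}" and ex: "\<exists>k. t < E k f x" by auto
    then have "x \<in> A (LEAST k. t < E k f x)"
      using LeastI_ex[OF ex] not_less_Least by (auto simp: A_def)
    then show "x \<in> (\<Union>k. A k)" by blast
  qed (auto simp: A_def)
  have int_A: "integrable unit_interval (\<lambda>x. indicator (A k) x * f x)" for k
    using integrable_mult_indicator[OF A f(1)] by simp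
  have part: "t * measure unit_interval (A k) \<le> (\<integral>x. indicator (A k) x * f x \<partial>unit_interval)" for k
  proof -
    have "t * measure unit_interval (A k) = (\<integral>x. indicator (A k) x * t \<partial>unit_interval)"
      using sets.sets_into_space[OF A] by (simp add: Int_absorb2)
    also have "\<dots> \<le> (\<integral>x. indicator (A k) x * E k f x \<partial>unit_interval)"
    proof (rule integral_mono)
      show "integrable unit_interval (\<lambda>x. indicator (A k) x * t)"
        using integrable_mult_indicator[OF A unit.integrable_const[of t]] by simp
      show "integrable unit_interval (\<lambda>x. indicator (A k) x * E k f x)"
        using integrable_mult_indicator[OF A dyadic.real_cond_exp_int(1)[OF f(1)]] by (simp add: E_def)
    qed (auto simp: A_def indicator_def)
    also have "\<dots> = (\<integral>x. indicator (A k) x * f x \<partial>unit_interval)"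
      using dyadic.real_cond_exp_intA[OF f(1) A_dyadic]
      by (simp add: E_def set_lebesgue_integral_def)
    finally show ?thesis .
  qed
  have "(\<Sum>k<N. t * measure unit_interval (A k)) \<le> (\<integral>x. f x \<partial>unit_interval)" for N
  proof -
    have "(\<Sum>k<N. t * measure unit_interval (A k))
        \<le> (\<Sum>k<N. \<integral>x. indicator (A k) x * f x \<partial>unit_interval)"
      by (intro sum_mono part)
    also have "\<dots> = (\<integral>x. (\<Sum>k<N. indicator (A k) x * f x) \<partial>unit_interval)"
      by (rule Bochner_Integration.integral_sum[symmetric]) (rule int_A)
    also have "\<dots> \<le> (\<integral>x. f x \<partial>unit_interval)"
    proof (rule integral_mono)
      fix x
      have "(\<Sum>k<N. indicator (A k) x * f x) = indicator (\<Union>k<N. A k) x * f x"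
        using disj by (subst indicator_UN_disjoint)
          (auto simp: sum_distrib_right disjoint_family_on_def)
      then show "(\<Sum>k<N. indicator (A k) x * f x) \<le> f x"
        by (simp only:) (simp add: indicator_def f(2))
    qed (intro Bochner_Integration.integrable_sum int_A f(1))+
    finally show ?thesis .
  qed
  moreover have "(\<lambda>k. t * measure unit_interval (A k)) sums (t * measure unit_interval (\<Union>k. A k))"
    by (intro sums_mult unit.finite_measure_UNION) (use A disj in auto)
  ultimately show ?thesis
    unfolding Un by (metis sums_summable sums_unique suminf_le_const)
qed


section \<open>Boundedness for digits of bounded weighted variation\<close>

lemma weights_pos: "weights \<Omega> \<Longrightarrow> 0 < \<Omega> k n"
  unfolding weights_def by (metis add_diff_cancel_right' le_add2)

lemma weights_Suc: "weights \<Omega> \<Longrightarrow> \<Omega> k n \<le> \<Omega> (Suc k) n"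
  unfolding weights_def by (metis diff_Suc_1 le_add1 plus_1_eq_Suc)

lemma weights_mono: "weights \<Omega> \<Longrightarrow> j \<le> k \<Longrightarrow> \<Omega> j n \<le> \<Omega> k n"
  by (rule lift_Suc_mono_le[of "\<lambda>k. \<Omega> k n"]) (rule weights_Suc)

text \<open>
  The quantity bounded in the hypothesis of the boundedness part, truncated at level \<open>s\<close> so that it
  is accessible to induction.
\<close>

definition digit_variation :: "(nat \<Rightarrow> nat \<Rightarrow> real) \<Rightarrow> nat \<Rightarrow> nat \<Rightarrow> real" where
  "digit_variation \<Omega> n s = (\<Sum>k=0..s.
     \<bar>(if k = 0 then 0 else real (eps (k - 1) n)) - real (eps k n)\<bar> * \<Omega> k n)"

text \<open>
  Put \<open>b k = eps k n * \<Omega> k n\<close>. Summation by parts replaces the martingale differences by the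
  values \<open>e k\<close> with coefficients \<open>b k - b (k + 1)\<close>. Monotonicity of the weights gives
  \<open>\<bar>b (k + 1) - b k\<bar> \<le> 2 * v + (b (k + 1) - b k)\<close>, where \<open>v\<close> is the corresponding term of the digit
  variation: inside a block of ones \<open>v = 0\<close> and \<open>b\<close> increases, and at the end of a block the drop
  is at most the next weight. The increments of \<open>b\<close> telescope, which is why the bound contains the last
  coefficient only. The boundary term stays on the left so that the induction closes.
\<close>

lemma abel_summation_bound:
  assumes w: "weights \<Omega>" and e: "\<And>k. \<bar>e k\<bar> \<le> m"
  shows "\<bar>(\<Sum>k<Suc s. real (eps k n) * \<Omega> k n * (e (k + 1) - e k))
            - real (eps s n) * \<Omega> s n * e (Suc s)\<bar>
          \<le> m * (2 * digit_variation \<Omega> n s + real (eps s n) * \<Omega> s n)"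
proof (induction s)
  case 0
  have "\<bar>e 0\<bar> * \<Omega> 0 n \<le> m * (3 * \<Omega> 0 n)"
    using e[of 0] weights_pos[OF w, of 0 n] by (intro mult_mono) auto
  then show ?case
    using weights_pos[OF w, of 0 n]
    by (auto simp: digit_variation_def eps_def algebra_simps abs_mult)
next
  case (Suc s)
  define b where "b k = real (eps k n) * \<Omega> k n" for k
  define v where "v = \<bar>real (eps s n) - real (eps (Suc s) n)\<bar> * \<Omega> (Suc s) n"
  have m: "0 \<le> m" using e[of 0] by linarith
  have V: "digit_variation \<Omega> n (Suc s) = digit_variation \<Omega> n s + v"
    by (simp add: digit_variation_def v_def)
  \<comment> \<open>four cases, according to the two consecutive digits\<close>
  have b_diff: "\<bar>b (Suc s) - b s\<bar> \<le> 2 * v + (b (Suc s) - b s)"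
    using weights_Suc[OF w, of s n] weights_pos[OF w, of s n] weights_pos[OF w, of "Suc s" n]
    by (auto simp: b_def v_def eps_def)
  have "\<bar>(b s - b (Suc s)) * e (Suc s)\<bar> \<le> (2 * v + (b (Suc s) - b s)) * m"
    unfolding abs_mult using b_diff e[of "Suc s"] by (intro mult_mono) auto
  moreover have "(\<Sum>k<Suc (Suc s). b k * (e (k + 1) - e k)) - b (Suc s) * e (Suc (Suc s))
     = ((\<Sum>k<Suc s. b k * (e (k + 1) - e k)) - b s * e (Suc s)) + (b s - b (Suc s)) * e (Suc s)"
    by (simp add: algebra_simps)
  ultimately show ?case
    using Suc unfolding V b_def[symmetric] by (simp add: algebra_simps)
qed

lemma weighted_sum_le_maximal:
  assumes w: "weights \<Omega>" and m: "\<And>k. \<bar>E k (\<lambda>y. f y * walsh n y) x\<bar> \<le> m"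
  shows "\<bar>weighted_sum \<Omega> n f x\<bar>
     \<le> m * (2 * digit_variation \<Omega> n (order_of n) + 2 * \<Omega> (order_of n) n)"
proof -
  define s where "s = order_of n"
  let ?e = "\<lambda>k. E k (\<lambda>y. f y * walsh n y) x"
  have m0: "0 \<le> m" using m[of 0] by linarith
  have "weighted_sum \<Omega> n f x = (\<Sum>k<Suc s. real (eps k n) * \<Omega> k n * (?e (k + 1) - ?e k))"
    by (subst weighted_sum_eq_sum[of "Suc s"]) (auto simp: s_def eps_above_order E_diff_def)
  moreover have "\<bar>real (eps s n) * \<Omega> s n * ?e (Suc s)\<bar> \<le> \<Omega> s n * m"
    unfolding abs_mult using m[of "Suc s"] weights_pos[OF w, of s n]
    by (intro mult_mono) (auto simp: eps_def)
  moreover have "m * (real (eps s n) * \<Omega> s n) \<le> m * \<Omega> s n"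
    using m0 weights_pos[OF w, of s n] by (intro mult_left_mono) (auto simp: eps_def)
  ultimately show ?thesis
    using abel_summation_bound[of \<Omega> ?e m n s, OF w m] unfolding s_def[symmetric]
    by (simp add: algebra_simps)
qed

text \<open>
  Walsh functions have modulus one, so all conditional expectations of all modulations of \<open>f\<close> are
  dominated by those of \<open>\<bar>f\<bar>\<close>. The exceptional set is common to all \<open>n\<close> and \<open>k\<close>, as the pointwise
  supremum over \<open>n\<close> requires.
\<close>

lemma AE_E_walsh_bound:
  assumes f: "integrable unit_interval f"
  shows "AE x in unit_interval. \<forall>n k. \<bar>E k (\<lambda>y. f y * walsh n y) x\<bar> \<le> E k (\<lambda>y. \<bar>f y\<bar>) x"
  unfolding AE_all_countable
proof (intro allI)
  fix n k
  let ?g = "\<lambda>y. f y * walsh n y"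
  have g: "integrable unit_interval ?g" by (rule integrable_walsh_mult[OF f])
  have bound: "- \<bar>f y\<bar> \<le> ?g y" "?g y \<le> \<bar>f y\<bar>" for y
    using abs_ge_self[of "?g y"] abs_ge_minus_self[of "?g y"] by (simp_all add: abs_mult)
  have "AE x in unit_interval. E k ?g x \<le> E k (\<lambda>y. \<bar>f y\<bar>) x"
    unfolding E_def by (rule dyadic.real_cond_exp_mono) (use f g bound in auto)
  moreover have "AE x in unit_interval. E k (\<lambda>y. (-1) * \<bar>f y\<bar>) x \<le> E k ?g x"
    unfolding E_def by (rule dyadic.real_cond_exp_mono) (use f g bound in auto)
  moreover have "AE x in unit_interval. E k (\<lambda>y. (-1) * \<bar>f y\<bar>) x = (-1) * E k (\<lambda>y. \<bar>f y\<bar>) x"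
    unfolding E_def by (rule dyadic.real_cond_exp_cmult) (use f in auto)
  ultimately show "AE x in unit_interval. \<bar>E k ?g x\<bar> \<le> E k (\<lambda>y. \<bar>f y\<bar>) x"
    by eventually_elim auto
qed

lemma weak_type_W_C_seq:
  assumes w: "weights \<Omega>" and C: "0 < C"
    and bound: "\<And>a. 2 * digit_variation \<Omega> (ns a) (order_of (ns a))
                   + 2 * \<Omega> (order_of (ns a)) (ns a) \<le> C"
  shows "weak_type_norm (W_C_seq \<Omega> ns) \<le> ennreal C"
  unfolding weak_type_norm_def weak_L1_norm_def
proof (intro SUP_least)
  fix f :: "real \<Rightarrow> real" and t :: real
  assume "f \<in> {f. integrable unit_interval f \<and> (\<integral>x. \<bar>f x\<bar> \<partial>unit_interval) \<le> 1}" and "t \<in> {0<..}"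
  then have f: "integrable unit_interval f" "(\<integral>x. \<bar>f x\<bar> \<partial>unit_interval) \<le> 1" and t: "0 < t"
    by auto
  let ?F = "\<lambda>y. \<bar>f y\<bar>"
  let ?B = "{x \<in> {0..<1}. \<exists>k. t / C < E k ?F x}"
  have B: "?B \<in> sets unit_interval"
  proof -
    have "{x \<in> space unit_interval. \<exists>k. t / C < E k ?F x} \<in> sets unit_interval"
      by measurable
    then show ?thesis by simp
  qed
  have "emeasure unit_interval {x \<in> {0..<1}. ennreal t < W_C_seq \<Omega> ns f x} \<le> emeasure unit_interval ?B"
  proof (rule emeasure_mono_AE[OF _ B])
    show "AE x in unit_interval. x \<in> {x \<in> {0..<1}. ennreal t < W_C_seq \<Omega> ns f x} \<longrightarrow> x \<in> ?B"
      using AE_E_walsh_bound[OF f(1)]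
    proof eventually_elim
      case (elim x)
      show ?case
      proof (intro impI)
        assume x: "x \<in> {x \<in> {0..<1}. ennreal t < W_C_seq \<Omega> ns f x}"
        then obtain a where a: "ennreal t < ennreal \<bar>weighted_sum \<Omega> (ns a) f x\<bar>"
          unfolding W_C_seq_def by (auto simp: less_SUP_iff)
        have "\<exists>k. t / C < E k ?F x"
        proof (rule ccontr)
          assume "\<nexists>k. t / C < E k ?F x"
          then have m: "\<bar>E k (\<lambda>y. f y * walsh (ns a) y) x\<bar> \<le> t / C" for k
            using elim by (meson not_le_imp_less order_trans)
          have "\<bar>weighted_sum \<Omega> (ns a) f x\<bar> \<le> t / C * C"
            using weighted_sum_le_maximal[OF w m] mult_left_mono[OF bound, of "t / C" a] t C
            by (meson divide_nonneg_pos less_imp_le order_trans)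
          then show False
            using a C t by (simp add: ennreal_less_iff)
        qed
        then show "x \<in> ?B" using x by auto
      qed
    qed
  qed
  moreover have "t * measure unit_interval ?B \<le> C"
  proof -
    have "t / C * measure unit_interval ?B \<le> (\<integral>x. ?F x \<partial>unit_interval)"
      by (rule dyadic_maximal_inequality) (use f t C in auto)
    then have "t / C * measure unit_interval ?B \<le> 1" using f(2) by linarith
    then show ?thesis using C by (simp add: pos_divide_le_eq)
  qed
  ultimately have "ennreal t * emeasure unit_interval {x \<in> {0..<1}. ennreal t < W_C_seq \<Omega> ns f x}
      \<le> ennreal t * emeasure unit_interval ?B"
    by (intro mult_left_mono) auto
  also have "\<dots> = ennreal (t * measure unit_interval ?B)"
    using t by (simp only: unit.emeasure_eq_measure ennreal_mult' less_imp_le)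
  also have "\<dots> \<le> ennreal C"
    by (rule ennreal_leI) fact
  finally show "ennreal t * emeasure unit_interval {x \<in> {0..<1}. ennreal t < W_C_seq \<Omega> ns f x}
      \<le> ennreal C" .
qed

lemma SUP_ereal_bound:
  assumes "(SUP a. ereal (g a)) < \<infinity>"
  shows "\<exists>B. \<forall>a. g a \<le> B"
proof (cases "SUP a. ereal (g a)")
  case (real r)
  then show ?thesis by (metis SUP_upper UNIV_I ereal_less_eq(3))
next
  case MInf
  then have "ereal (g undefined) \<le> - \<infinity>" by (metis SUP_upper UNIV_I)
  then show ?thesis by simp
qed (use assms in auto)

lemma bounded_variation_weak_type:
  assumes w: "weights \<Omega>"
    and V: "(SUP a. ereal (digit_variation \<Omega> (ns a) (order_of (ns a)))) < \<infinity>"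
    and top: "(SUP a. ereal (\<Omega> (order_of (ns a)) (ns a))) < \<infinity>"
  shows "weak_type_norm (W_C_seq \<Omega> ns) < \<infinity>"
proof -
  obtain B where B: "\<And>a. digit_variation \<Omega> (ns a) (order_of (ns a)) \<le> B"
    using SUP_ereal_bound[OF V] by auto
  obtain B' where B': "\<And>a. \<Omega> (order_of (ns a)) (ns a) \<le> B'"
    using SUP_ereal_bound[OF top] by auto
  have "weak_type_norm (W_C_seq \<Omega> ns) \<le> ennreal (max 1 (2 * B + 2 * B'))"
    by (rule weak_type_W_C_seq[OF w]) (use B B' in \<open>auto intro: add_mono simp: le_max_iff_disj\<close>)
  then show ?thesis
    by (rule le_less_trans) simp
qed

section \<open>Cylinders and point masses\<close>

text \<open>
  Passes between the digits, in which the combinatorics is done, and the integer parts, which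
  describe dyadic intervals.
\<close>

lemma digits_eq_iff_floor_eq:
  assumes "x \<in> {0..<1}" "y \<in> {0..<1}"
  shows "(\<forall>j<k. digit j x = digit j y) \<longleftrightarrow> \<lfloor>x * 2 ^ k\<rfloor> = \<lfloor>y * 2 ^ k\<rfloor>"
proof
  assume "\<forall>j<k. digit j x = digit j y"
  then have "(\<Sum>j<k. real (digit j x) / 2 ^ (j + 1)) = (\<Sum>j<k. real (digit j y) / 2 ^ (j + 1))"
    by (intro sum.cong) auto
  then have "real_of_int \<lfloor>x * 2 ^ k\<rfloor> / 2 ^ k = real_of_int \<lfloor>y * 2 ^ k\<rfloor> / 2 ^ k"
    using digit_partial_sum[of x k] digit_partial_sum[of y k] assms
    by (simp only: atLeastLessThan_iff)
  then show "\<lfloor>x * 2 ^ k\<rfloor> = \<lfloor>y * 2 ^ k\<rfloor>" by simp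
next
  assume eq: "\<lfloor>x * 2 ^ k\<rfloor> = \<lfloor>y * 2 ^ k\<rfloor>"
  have floor: "\<lfloor>z * 2 ^ (j + 1)\<rfloor> = \<lfloor>z * 2 ^ k\<rfloor> div 2 ^ (k - (j + 1))" if "j < k" for j and z :: real
  proof -
    have "(2::real) ^ k = 2 ^ (j + 1) * 2 ^ (k - (j + 1))"
      unfolding power_add[symmetric] using that by (intro arg_cong2[of _ _ _ _ power]) auto
    then have "z * 2 ^ (j + 1) = z * 2 ^ k / real_of_int (2 ^ (k - (j + 1)))"
      by (simp add: field_simps)
    then show ?thesis
      by (simp only: floor_divide_real_eq_div zero_le_power zero_le_numeral)
  qed
  show "\<forall>j<k. digit j x = digit j y"
  proof (intro allI impI)
    fix j assume j: "j < k"
    show "digit j x = digit j y"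
      unfolding digit_def floor[OF j] eq ..
  qed
qed

definition cylinder :: "nat \<Rightarrow> real \<Rightarrow> real set" where
  "cylinder k t = {x \<in> {0..<1}. \<forall>j<k. digit j x = digit j t}"

lemma cylinder_floor:
  "t \<in> {0..<1} \<Longrightarrow> cylinder k t = {x \<in> {0..<1}. \<lfloor>x * 2 ^ k\<rfloor> = \<lfloor>t * 2 ^ k\<rfloor>}"
  unfolding cylinder_def using digits_eq_iff_floor_eq by blast

lemma mem_dyadic_interval:
  "x \<in> {real j / 2 ^ k ..< (real j + 1) / 2 ^ k} \<longleftrightarrow> \<lfloor>x * 2 ^ k\<rfloor> = int j"
  by (auto simp: floor_eq_iff field_simps)

lemma cylinder_interval:
  assumes t: "t \<in> {0..<1}"
  obtains j where "j < 2 ^ k" "cylinder k t = {real j / 2 ^ k ..< (real j + 1) / 2 ^ k}"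
proof -
  define j where "j = nat \<lfloor>t * 2 ^ k\<rfloor>"
  have pos: "0 \<le> \<lfloor>t * 2 ^ k\<rfloor>" using t by simp
  have "t * 2 ^ k < 1 * 2 ^ k" using t by (intro mult_strict_right_mono) auto
  then have "\<lfloor>t * 2 ^ k\<rfloor> < 2 ^ k" by (simp add: floor_less_iff)
  then have j: "j < 2 ^ k" using pos by (simp add: j_def nat_less_iff)
  then have "{real j / 2 ^ k ..< (real j + 1) / 2 ^ k} \<in> dyadic_intervals k"
    unfolding dyadic_intervals_def by blast
  then have sub: "x \<in> {real j / 2 ^ k ..< (real j + 1) / 2 ^ k} \<Longrightarrow> x \<in> {0..<1}" for x
    using dyadic_intervals_subset[of k] by blast
  have "int j = \<lfloor>t * 2 ^ k\<rfloor>" using pos by (simp add: j_def)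
  then have "cylinder k t = {real j / 2 ^ k ..< (real j + 1) / 2 ^ k}"
    using sub unfolding cylinder_floor[OF t] set_eq_iff mem_Collect_eq mem_dyadic_interval[of _ j k]
    by (simp only:) blast
  with j show ?thesis by (rule that)
qed

lemma cylinder_dyadic:
  assumes "t \<in> {0..<1}"
  shows "cylinder k t \<in> sets (dyadic_algebra k)"
proof -
  obtain j where "j < 2 ^ k" "cylinder k t = {real j / 2 ^ k ..< (real j + 1) / 2 ^ k}"
    using assms by (rule cylinder_interval)
  then have "cylinder k t \<in> dyadic_intervals k"
    unfolding dyadic_intervals_def by blast
  then show ?thesis
    unfolding sets_dyadic_algebra by (rule sigma_sets.Basic)
qed

lemma cylinder_sets [measurable]: "t \<in> {0..<1} \<Longrightarrow> cylinder k t \<in> sets unit_interval"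
  using cylinder_dyadic[of t k] subalgebra_dyadic_algebra[of k] unfolding subalgebra_def by blast

lemma measure_cylinder: "t \<in> {0..<1} \<Longrightarrow> measure unit_interval (cylinder k t) = 1 / 2 ^ k"
proof -
  assume t: "t \<in> {0..<1}"
  obtain j where "j < 2 ^ k" and eq: "cylinder k t = {real j / 2 ^ k ..< (real j + 1) / 2 ^ k}"
    using t by (rule cylinder_interval)
  have "measure unit_interval (cylinder k t) = measure lebesgue (cylinder k t)"
    by (rule measure_restrict_space) (auto simp: cylinder_def)
  also have "\<dots> = 1 / 2 ^ k"
    unfolding eq by (simp add: diff_divide_distrib[symmetric] divide_right_mono)
  finally show ?thesis .
qed

lemma cylinder_antimono: "k \<le> R \<Longrightarrow> cylinder R t \<subseteq> cylinder k t"
  by (auto simp: cylinder_def)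

text \<open>
  Cylinders are the atoms of the finite algebra; this is what identifies conditional expectations of
  functions that live on cylinders.
\<close>

lemma cylinder_atom:
  assumes t: "t \<in> {0..<1}" and A: "A \<in> sets (dyadic_algebra k)"
  shows "cylinder k t \<subseteq> A \<or> cylinder k t \<inter> A = {}"
  using A unfolding sets_dyadic_algebra
proof (induction rule: sigma_sets.induct)
  case (Basic I)
  then obtain j where "I = {real j / 2 ^ k ..< (real j + 1) / 2 ^ k}"
    unfolding dyadic_intervals_def by blast
  then have I: "x \<in> I \<longleftrightarrow> \<lfloor>x * 2 ^ k\<rfloor> = int j" for x
    by (simp only: mem_dyadic_interval)
  show ?case
    by (cases "\<lfloor>t * 2 ^ k\<rfloor> = int j") (auto simp only: I cylinder_floor[OF t])
next
  case (Compl A)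
  then show ?case by (auto simp: cylinder_def)
qed blast+

text \<open>
  Averaging a normalised indicator of a small cylinder over the larger cylinders around it gives the
  normalised indicator of the larger cylinder: this is how \<open>2 ^ R * indicator (cylinder R t)\<close> acts
  as a point mass at \<open>t\<close> for all levels up to \<open>R\<close>.
\<close>

lemma E_cylinder:
  assumes t: "t \<in> {0..<1}" and k: "k \<le> R"
  shows "AE x in unit_interval.
    E k (\<lambda>x. 2 ^ R * indicator (cylinder R t) x) x = 2 ^ k * indicator (cylinder k t) x"
  unfolding E_def
proof (rule dyadic.real_cond_exp_charact)
  fix A assume A: "A \<in> sets (dyadic_algebra k)"
  have int: "(\<integral>x\<in>A. (2::real) ^ m * indicator (cylinder m t) x \<partial>unit_interval) = of_bool (cylinder k t \<subseteq> A)"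
    if m: "k \<le> m" for m
  proof -
    have "(\<integral>x\<in>A. (2::real) ^ m * indicator (cylinder m t) x \<partial>unit_interval)
        = (\<integral>x. of_bool (cylinder k t \<subseteq> A) * (2 ^ m * indicator (cylinder m t) x) \<partial>unit_interval)"
    proof -
      have "indicator A x *\<^sub>R ((2::real) ^ m * indicator (cylinder m t) x)
          = of_bool (cylinder k t \<subseteq> A) * (2 ^ m * indicator (cylinder m t) x)" for x
      proof (cases "x \<in> cylinder m t")
        case True
        then have "x \<in> cylinder k t" using cylinder_antimono[OF m] by blast
        then have "x \<in> A \<longleftrightarrow> cylinder k t \<subseteq> A" using cylinder_atom[OF t A] by blast
        then show ?thesis by (simp add: indicator_def)
      qed simp
      then show ?thesis by (simp only: set_lebesgue_integral_def)
    qed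
    also have "\<dots> = of_bool (cylinder k t \<subseteq> A)"
      using measure_cylinder[OF t, of m] sets.sets_into_space[OF cylinder_sets[OF t, of m]]
      by (simp add: Int_absorb2)
    finally show ?thesis .
  qed
  show "(\<integral>x\<in>A. (2::real) ^ R * indicator (cylinder R t) x \<partial>unit_interval)
      = (\<integral>x\<in>A. 2 ^ k * indicator (cylinder k t) x \<partial>unit_interval)"
    by (simp only: int k order_refl)
next
  have "integrable unit_interval (\<lambda>x. 2 ^ m * indicator (cylinder m t) x :: real)" for m
    using t by (intro integrable_mult_right integrable_real_indicator)
      (auto simp: unit.emeasure_eq_measure)
  then show "integrable unit_interval (\<lambda>x. 2 ^ R * indicator (cylinder R t) x :: real)"
    "integrable unit_interval (\<lambda>x. 2 ^ k * indicator (cylinder k t) x :: real)" by auto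
  show "(\<lambda>x. 2 ^ k * indicator (cylinder k t) x :: real) \<in> borel_measurable (dyadic_algebra k)"
    using cylinder_dyadic[OF t, of k] by measurable
qed

text \<open>
  The digits are prepended one at a time by the inverse branches \<open>t \<mapsto> (d + t) / 2\<close> of the doubling map.
\<close>

lemma exists_digits: "\<exists>t. t \<in> {0..<1} \<and> (\<forall>j<R. digit j t = of_bool (d j))"
proof (induction R arbitrary: d)
  case 0
  show ?case by (intro exI[of _ 0]) auto
next
  case (Suc R)
  obtain t where t: "t \<in> {0..<1}" and dt: "\<forall>j<R. digit j t = of_bool (d (Suc j))"
    using Suc.IH[of "\<lambda>j. d (Suc j)"] by blast
  define u where "u = (of_bool (d 0) + t) / 2"
  have "u \<in> {0..<1}" using t by (auto simp: u_def)
  moreover have "digit j u = of_bool (d j)" if "j < Suc R" for j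
  proof (cases j)
    case 0
    have "\<lfloor>of_bool (d 0) + t\<rfloor> = of_bool (d 0)" using t by (simp add: floor_eq_iff)
    moreover have "u * 2 ^ (0 + 1) = of_bool (d 0) + t" by (simp add: u_def)
    ultimately have "digit 0 u = nat (of_bool (d 0) mod 2)" by (simp only: digit_def)
    then show ?thesis using 0 by auto
  next
    case (Suc j')
    have "u * 2 ^ (j + 1) = t * 2 ^ (j' + 1) + real_of_int (2 * (of_bool (d 0) * 2 ^ j'))"
      by (simp add: u_def Suc algebra_simps)
    then have "\<lfloor>u * 2 ^ (j + 1)\<rfloor> = \<lfloor>t * 2 ^ (j' + 1)\<rfloor> + 2 * (of_bool (d 0) * 2 ^ j')"
      by (simp only: floor_add_int[symmetric])
    then have "digit j u = digit j' t" by (simp add: digit_def)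
    then show ?thesis using dt Suc that by simp
  qed
  ultimately show ?case by blast
qed

lemma walsh_cylinder:
  assumes "\<And>k. R \<le> k \<Longrightarrow> eps k n = 0" and "x \<in> cylinder R t"
  shows "walsh n x = walsh n t"
  using assms by (simp add: walsh_eq_prod[of R] rademacher_def cylinder_def)

definition point_masses :: "real \<Rightarrow> nat \<Rightarrow> nat set \<Rightarrow> (nat \<Rightarrow> real) \<Rightarrow> real \<Rightarrow> real" where
  "point_masses \<alpha> R I t x = (\<Sum>i\<in>I. \<alpha> * (2 ^ R * indicator (cylinder R (t i)) x))"

lemma integrable_cylinder:
  "t \<in> {0..<1} \<Longrightarrow> integrable unit_interval (\<lambda>x. \<alpha> * (2 ^ R * indicator (cylinder R t) x) :: real)"
  by (intro integrable_mult_right integrable_real_indicator) (auto simp: unit.emeasure_eq_measure)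

lemma integrable_point_masses:
  assumes "\<And>i. t i \<in> {0..<1}"
  shows "integrable unit_interval (point_masses \<alpha> R I t)"
  unfolding point_masses_def by (intro Bochner_Integration.integrable_sum integrable_cylinder assms)

lemma norm_point_masses:
  assumes t: "\<And>i. t i \<in> {0..<1}" and "0 \<le> \<alpha>"
  shows "(\<integral>x. \<bar>point_masses \<alpha> R I t x\<bar> \<partial>unit_interval) = \<alpha> * card I"
proof -
  have "(\<integral>x. \<bar>point_masses \<alpha> R I t x\<bar> \<partial>unit_interval) = (\<integral>x. point_masses \<alpha> R I t x \<partial>unit_interval)"
    using \<open>0 \<le> \<alpha>\<close> by (simp add: point_masses_def sum_nonneg)
  also have "\<dots> = (\<Sum>i\<in>I. \<integral>x. \<alpha> * (2 ^ R * indicator (cylinder R (t i)) x) \<partial>unit_interval)"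
    unfolding point_masses_def by (intro Bochner_Integration.integral_sum integrable_cylinder t)
  also have "\<dots> = (\<Sum>i\<in>I. \<alpha>)"
    using measure_cylinder[OF t, of R] sets.sets_into_space[OF cylinder_sets[OF t, of R]]
    by (intro sum.cong) (simp_all add: Int_absorb2)
  finally show ?thesis by simp
qed

lemma E_point_masses:
  assumes t: "\<And>i. t i \<in> {0..<1}" and n: "\<And>k. R \<le> k \<Longrightarrow> eps k n = 0" and k: "k \<le> R"
  shows "AE x in unit_interval. E k (\<lambda>y. point_masses \<alpha> R I t y * walsh n y) x
    = (\<Sum>i\<in>I. \<alpha> * walsh n (t i) * (2 ^ k * indicator (cylinder k (t i)) x))"
proof -
  let ?h = "\<lambda>i y. \<alpha> * walsh n (t i) * (2 ^ R * indicator (cylinder R (t i)) y)"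
  have "point_masses \<alpha> R I t y * walsh n y = (\<Sum>i\<in>I. ?h i y)" for y
    unfolding point_masses_def sum_distrib_right
    by (intro sum.cong) (auto simp: indicator_def walsh_cylinder[OF n])
  then have eq: "(\<lambda>y. point_masses \<alpha> R I t y * walsh n y) = (\<lambda>y. \<Sum>i\<in>I. ?h i y)"
    by blast
  have "AE x in unit_interval. E k (\<lambda>y. \<Sum>i\<in>I. ?h i y) x = (\<Sum>i\<in>I. E k (?h i) x)"
    unfolding E_def by (intro dyadic.real_cond_exp_sum integrable_cylinder t)
  moreover have "AE x in unit_interval. \<forall>i. E k (?h i) x
      = \<alpha> * walsh n (t i) * (2 ^ k * indicator (cylinder k (t i)) x)"
    unfolding AE_all_countable
  proof
    fix i
    have "AE x in unit_interval. E k (?h i) x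
      = \<alpha> * walsh n (t i) * E k (\<lambda>y. 2 ^ R * indicator (cylinder R (t i)) y) x"
      unfolding E_def using integrable_cylinder[OF t, of 1]
      by (intro dyadic.real_cond_exp_cmult) simp
    then show "AE x in unit_interval. E k (?h i) x
      = \<alpha> * walsh n (t i) * (2 ^ k * indicator (cylinder k (t i)) x)"
      using E_cylinder[OF t k, of i] by eventually_elim simp
  qed
  ultimately show ?thesis
    unfolding eq by eventually_elim simp
qed

section \<open>The weighted Walsh kernel\<close>

text \<open>
  The value of the weighted kernel \<open>\<Sum>k. \<epsilon>\<^sub>k \<Omega>\<^sub>k r\<^sub>k D\<^bsub>2^k\<^esub>\<close>, where \<open>D\<close> is the Walsh--Dirichlet kernel,
  at a point whose first nonzero digit has position \<open>J\<close>: there \<open>D\<^bsub>2^k\<^esub>\<close> is \<open>2^k\<close> for \<open>k \<le> J\<close> and vanishes for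
  larger \<open>k\<close>, and \<open>r\<^sub>k\<close> is \<open>1\<close> for \<open>k < J\<close> and \<open>-1\<close> for \<open>k = J\<close>.
\<close>

definition walsh_kernel :: "(nat \<Rightarrow> nat \<Rightarrow> real) \<Rightarrow> nat \<Rightarrow> nat \<Rightarrow> real" where
  "walsh_kernel \<Omega> n J = (\<Sum>k<J. real (eps k n) * \<Omega> k n * 2 ^ k) - real (eps J n) * \<Omega> J n * 2 ^ J"

lemma weighted_sum_cylinder_differences:
  assumes x: "x \<in> {0..<1}" and J: "J < R" "\<And>j. j < J \<Longrightarrow> digit j x = digit j t" "digit J x \<noteq> digit J t"
  shows "(\<Sum>k<R. real (eps k n) * \<Omega> k n *
      (2 ^ (k + 1) * indicator (cylinder (k + 1) t) x - 2 ^ k * indicator (cylinder k t) x))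
    = walsh_kernel \<Omega> n J"
proof -
  have ind: "indicator (cylinder k t) x = (of_bool (k \<le> J) :: real)" for k
    using J(2,3) x by (auto simp: cylinder_def indicator_def) (meson le_trans linorder_not_le)
  have "(\<Sum>k<R. real (eps k n) * \<Omega> k n *
      (2 ^ (k + 1) * indicator (cylinder (k + 1) t) x - 2 ^ k * indicator (cylinder k t) x))
    = (\<Sum>k<Suc J. real (eps k n) * \<Omega> k n *
      (2 ^ (k + 1) * indicator (cylinder (k + 1) t) x - 2 ^ k * indicator (cylinder k t) x))"
    by (rule sum.mono_neutral_right) (use J(1) in \<open>auto simp: ind\<close>)
  also have "\<dots> = walsh_kernel \<Omega> n J"
    by (simp add: ind walsh_kernel_def algebra_simps)
  finally show ?thesis .
qed

text \<open>
  Below the resolution \<open>R\<close> the operator sees each mass through the kernel, which depends only on the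
  position \<open>J i\<close> where \<open>x\<close> first differs from \<open>t i\<close>. The quantifier over \<open>J\<close> is inside because these positions
  depend on \<open>x\<close>.
\<close>

lemma weighted_sum_point_masses:
  assumes t: "\<And>i. t i \<in> {0..<1}" and n: "\<And>k. R \<le> k \<Longrightarrow> eps k n = 0"
  shows "AE x in unit_interval. \<forall>J. (\<forall>i\<in>I. J i < R \<and> (\<forall>j<J i. digit j x = digit j (t i)) \<and>
        digit (J i) x \<noteq> digit (J i) (t i)) \<longrightarrow>
      weighted_sum \<Omega> n (point_masses \<alpha> R I t) x = (\<Sum>i\<in>I. \<alpha> * walsh n (t i) * walsh_kernel \<Omega> n (J i))"
proof -
  let ?c = "\<lambda>i. \<alpha> * walsh n (t i)"
  let ?D = "\<lambda>i k x. 2 ^ (k + 1) * indicator (cylinder (k + 1) (t i)) x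
                   - 2 ^ k * indicator (cylinder k (t i)) x :: real"
  have "AE x in unit_interval. \<forall>k\<in>{..R}. E k (\<lambda>y. point_masses \<alpha> R I t y * walsh n y) x
    = (\<Sum>i\<in>I. ?c i * (2 ^ k * indicator (cylinder k (t i)) x))"
    by (rule AE_finite_allI) (auto intro: E_point_masses[OF t n])
  then show ?thesis
    using AE_space
  proof eventually_elim
    case (elim x)
    show ?case
    proof (intro allI impI)
      fix J assume J: "\<forall>i\<in>I. J i < R \<and> (\<forall>j<J i. digit j x = digit j (t i)) \<and>
        digit (J i) x \<noteq> digit (J i) (t i)"
      have E_diff: "E_diff k (\<lambda>y. point_masses \<alpha> R I t y * walsh n y) x = (\<Sum>i\<in>I. ?c i * ?D i k x)"
        if "k < R" for k
        using elim(1)[rule_format, of k] elim(1)[rule_format, of "k + 1"] that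
        by (simp add: E_diff_def sum_subtractf right_diff_distrib)
      have "weighted_sum \<Omega> n (point_masses \<alpha> R I t) x
          = (\<Sum>k<R. real (eps k n) * \<Omega> k n * (\<Sum>i\<in>I. ?c i * ?D i k x))"
        by (subst weighted_sum_eq_sum[OF n]) (auto intro!: sum.cong simp: E_diff)
      also have "\<dots> = (\<Sum>k<R. \<Sum>i\<in>I. ?c i * (real (eps k n) * \<Omega> k n * ?D i k x))"
        unfolding sum_distrib_left by (intro sum.cong refl) (simp only: mult_ac)
      also have "\<dots> = (\<Sum>i\<in>I. ?c i * (\<Sum>k<R. real (eps k n) * \<Omega> k n * ?D i k x))"
        unfolding sum_distrib_left by (rule sum.swap)
      also have "\<dots> = (\<Sum>i\<in>I. ?c i * walsh_kernel \<Omega> n (J i))"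
        by (intro sum.cong refl arg_cong2[of _ _ _ _ "(*)"] weighted_sum_cylinder_differences)
          (use J elim(2) in auto)
      finally show "weighted_sum \<Omega> n (point_masses \<alpha> R I t) x = (\<Sum>i\<in>I. ?c i * walsh_kernel \<Omega> n (J i))" .
    qed
  qed
qed

lemma sum_powers_of_two: "(\<Sum>k<K. (2::real) ^ k) = 2 ^ K - 1"
  by (induction K) auto

text \<open>
  With alternating digits the sign of the kernel is known whatever the monotone weights are.
  If the digit at \<open>J = a + l\<close> is \<open>1\<close>, then the digit before it is \<open>0\<close>, so the positive terms sum to at
  most \<open>\<Omega> J n * 2 ^ (J - 1)\<close>, half of the negative term. If it is \<open>0\<close>, there is no negative term and the
  digit before it contributes \<open>\<Omega> (J - 1) n * 2 ^ (J - 1)\<close>. The assumption on \<open>a\<close> ensures that there is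
  always a digit before \<open>J\<close>.
\<close>

lemma walsh_kernel_sign:
  assumes w: "weights \<Omega>" and c: "0 < c" "c \<le> \<Omega> a n"
    and a: "1 \<le> a" and low: "\<And>k. k < a \<Longrightarrow> eps k n = 0"
    and mid: "\<And>l. l \<le> L \<Longrightarrow> eps (a + l) n = of_bool (even l)" and l: "l \<le> L"
  shows "c * 2 ^ (a + l) \<le> 2 * ((if even l then - 1 else 1) * walsh_kernel \<Omega> n (a + l))"
proof -
  obtain K where K: "a + l = Suc K" using a by (metis Suc_le_D One_nat_def add_Suc)
  have two: "c * 2 ^ (a + l) = 2 * (c * 2 ^ K)"
    unfolding K by (simp only: power_Suc mult_ac)
  have pos: "0 \<le> real (eps k n) * \<Omega> k n * 2 ^ k" for k
    using weights_pos[OF w, of k n] by simp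
  show ?thesis
  proof (cases "even l")
    case True
    have "eps K n = 0"
    proof (cases l)
      case 0
      then show ?thesis using K low by simp
    next
      case (Suc l')
      then show ?thesis using K mid[of l'] l True by auto
    qed
    then have "(\<Sum>k<Suc K. real (eps k n) * \<Omega> k n * 2 ^ k) = (\<Sum>k<K. real (eps k n) * \<Omega> k n * 2 ^ k)"
      by simp
    also have "\<dots> \<le> (\<Sum>k<K. \<Omega> (Suc K) n * 2 ^ k)"
    proof (rule sum_mono)
      fix k assume "k \<in> {..<K}"
      then have "\<Omega> k n \<le> \<Omega> (Suc K) n" by (intro weights_mono[OF w]) simp
      then show "real (eps k n) * \<Omega> k n * 2 ^ k \<le> \<Omega> (Suc K) n * 2 ^ k"
        using weights_pos[OF w, of "Suc K" n] by (auto simp: eps_def)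
    qed
    also have "\<dots> = \<Omega> (Suc K) n * (2 ^ K - 1)"
      unfolding sum_distrib_left[symmetric] sum_powers_of_two ..
    also have "\<dots> \<le> \<Omega> (Suc K) n * 2 ^ K"
      using weights_pos[OF w, of "Suc K" n] by (intro mult_left_mono) auto
    finally have "walsh_kernel \<Omega> n (a + l) \<le> - (\<Omega> (Suc K) n * 2 ^ K)"
      using mid[OF l] True unfolding walsh_kernel_def K by (simp add: algebra_simps)
    moreover have "c * 2 ^ K \<le> \<Omega> (Suc K) n * 2 ^ K"
      using c(2) weights_mono[OF w, of a "Suc K" n] K by (intro mult_right_mono) auto
    ultimately have "c * 2 ^ K \<le> - walsh_kernel \<Omega> n (a + l)" by linarith
    then show ?thesis using True by (simp only: two if_True mult_minus_left mult_1 mult_le_cancel_left_pos zero_less_numeral)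
  next
    case False
    then obtain l' where l': "l = Suc l'" by (cases l) auto
    then have K': "K = a + l'" using K by simp
    have "c * 2 ^ K \<le> \<Omega> K n * 2 ^ K"
      using c(2) weights_mono[OF w, of a K n] K' by (intro mult_right_mono) auto
    also have "\<dots> = real (eps K n) * \<Omega> K n * 2 ^ K"
      using mid[of l'] l l' False unfolding K' by simp
    also have "\<dots> \<le> (\<Sum>k<Suc K. real (eps k n) * \<Omega> k n * 2 ^ k)"
      by (rule member_le_sum) (use pos in auto)
    also have "\<dots> = walsh_kernel \<Omega> n (a + l)"
      using mid[OF l] False unfolding walsh_kernel_def K by simp
    finally show ?thesis using False by (simp only: two if_False mult_1 mult_le_cancel_left_pos zero_less_numeral)
  qed
qed

section \<open>Binary words and the choice of the index\<close>

lemma nat_eq_of_low_bits: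
  fixes i i' :: nat
  assumes "i < 2 ^ L" "i' < 2 ^ L" "\<And>l. l < L \<Longrightarrow> bit i l = bit i' l"
  shows "i = i'"
proof -
  have "take_bit L i = take_bit L i'"
    by (rule bit_eqI) (auto simp: bit_take_bit_iff assms(3))
  then show ?thesis
    using assms(1,2) by (simp add: take_bit_nat_eq_self)
qed

text \<open>
  The numbers below \<open>2 ^ L\<close> serve as binary words of length \<open>L\<close>; the value \<open>L\<close> stands for words that
  agree throughout.
\<close>

definition first_difference :: "nat \<Rightarrow> nat \<Rightarrow> nat \<Rightarrow> nat" where
  "first_difference L i i' = (LEAST l. l = L \<or> bit i l \<noteq> bit i' l)"

lemma first_difference_le: "first_difference L i i' \<le> L"
  unfolding first_difference_def by (rule Least_le) simp

lemma bit_eq_below_first_difference: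
  "l < first_difference L i i' \<Longrightarrow> bit i l = bit i' l"
  unfolding first_difference_def using not_less_Least by blast

lemma bit_neq_at_first_difference:
  assumes "first_difference L i i' < L"
  shows "bit i (first_difference L i i') \<noteq> bit i' (first_difference L i i')"
proof -
  have "first_difference L i i' = L \<or>
      bit i (first_difference L i i') \<noteq> bit i' (first_difference L i i')"
    unfolding first_difference_def by (rule LeastI[of _ L]) simp
  then show ?thesis using assms by simp
qed

lemma le_first_difference:
  assumes "i mod 2 ^ l = i' mod 2 ^ l" "l \<le> L"
  shows "l \<le> first_difference L i i'"
proof (rule ccontr)
  assume *: "\<not> l \<le> first_difference L i i'"
  define d where "d = first_difference L i i'"
  have d: "d < l" using * by (simp add: d_def)
  have "bit (take_bit l i) d = bit (take_bit l i') d"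
    using assms(1) by (simp add: take_bit_eq_mod)
  then show False
    using bit_neq_at_first_difference[of L i i'] d assms(2) by (simp add: bit_take_bit_iff d_def)
qed

lemma card_same_residue:
  assumes "l \<le> L"
  shows "2 ^ (L - l) \<le> card {i'. i' < 2 ^ L \<and> i mod 2 ^ l = i' mod (2::nat) ^ l}"
proof -
  let ?g = "\<lambda>q. q * 2 ^ l + i mod 2 ^ l"
  have "?g q < 2 ^ L" if "q < 2 ^ (L - l)" for q
  proof -
    have "?g q < Suc q * 2 ^ l" by simp
    also have "\<dots> \<le> 2 ^ (L - l) * 2 ^ l"
      using that by (intro mult_right_mono) auto
    also have "\<dots> = 2 ^ L" using assms by (simp flip: power_add)
    finally show ?thesis .
  qed
  then have "?g ` {..<2 ^ (L - l)} \<subseteq> {i'. i' < 2 ^ L \<and> i mod 2 ^ l = i' mod 2 ^ l}"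
    by auto
  then have "card (?g ` {..<2 ^ (L - l)}) \<le> card {i'. i' < 2 ^ L \<and> i mod 2 ^ l = i' mod 2 ^ l}"
    by (intro card_mono) auto
  moreover have "card (?g ` {..<2 ^ (L - l)}) = 2 ^ (L - l)"
    by (subst card_image) (auto simp: inj_on_def)
  ultimately show ?thesis by simp
qed

text \<open>
  This is where the divergence comes from: for every \<open>l \<le> L\<close>, the \<open>2 ^ (L - l)\<close> words that agree with \<open>i\<close>
  in the first \<open>l\<close> letters contribute \<open>2 ^ l\<close> each, so every scale contributes the same amount \<open>2 ^ L\<close>
  and the \<open>L + 1\<close> scales add up. It is the discrete form of the divergence of
  the integral of \<open>1 / \<bar>x\<bar>\<close>.
\<close>

lemma sum_first_difference:
  "real (Suc L) * 2 ^ L \<le> (\<Sum>i'<2 ^ L. 2 * 2 ^ first_difference L i i')"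
proof -
  have "real (Suc L) * 2 ^ L = (\<Sum>l<Suc L. 2 ^ l * real (2 ^ (L - l)))"
    by (simp flip: power_add)
  also have "\<dots> \<le> (\<Sum>l<Suc L. 2 ^ l * real (card {i'. i' < 2 ^ L \<and> i mod 2 ^ l = i' mod 2 ^ l}))"
    by (intro sum_mono mult_left_mono of_nat_mono card_same_residue) auto
  also have "\<dots> = (\<Sum>l<Suc L. \<Sum>i'<2 ^ L. 2 ^ l * of_bool (i mod 2 ^ l = i' mod 2 ^ l))"
    by (intro sum.cong refl) (simp add: sum_distrib_left[symmetric] Int_def)
  also have "\<dots> = (\<Sum>i'<2 ^ L. \<Sum>l<Suc L. 2 ^ l * of_bool (i mod 2 ^ l = i' mod 2 ^ l))"
    by (rule sum.swap)
  also have "\<dots> \<le> (\<Sum>i'<2 ^ L. 2 * 2 ^ first_difference L i i')"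
  proof (rule sum_mono)
    fix i'
    let ?d = "first_difference L i i'"
    have "(\<Sum>l<Suc L. (2::real) ^ l * of_bool (i mod 2 ^ l = i' mod 2 ^ l))
        \<le> (\<Sum>l<Suc L. if l < Suc ?d then 2 ^ l else 0)"
      using le_first_difference[of i _ i' L] by (intro sum_mono) (auto simp: less_Suc_eq_le)
    also have "\<dots> = (\<Sum>l<Suc ?d. 2 ^ l)"
      by (rule sum.mono_neutral_cong_right) (use first_difference_le[of L i i'] in auto)
    also have "\<dots> \<le> 2 * 2 ^ ?d"
      by (simp only: sum_powers_of_two) simp
    finally show "(\<Sum>l<Suc L. (2::real) ^ l * of_bool (i mod 2 ^ l = i' mod 2 ^ l)) \<le> 2 * 2 ^ ?d" .
  qed
  finally show ?thesis .
qed

lemma exists_bits: "\<exists>n. \<forall>k. eps k n = of_bool (k < R \<and> d k)"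
proof
  show "\<forall>k. eps k (horner_sum of_bool 2 (map d [0..<R])) = of_bool (k < R \<and> d k)"
    by (auto simp: eps_def bit_horner_sum_bit_iff)
qed

lemma order_of_eqI:
  assumes "eps s n = 1" "\<And>k. s < k \<Longrightarrow> eps k n = 0"
  shows "order_of n = s"
  unfolding order_of_def
proof (rule Max_eqI[OF finite_eps])
  fix k assume "k \<in> {k. eps k n = 1}"
  then show "k \<le> s" using assms(2)[of k] by (cases "k \<le> s") auto
qed (use assms in auto)

text \<open>
  The point \<open>t i\<close> alone has a nonzero digit at position \<open>b + i\<close>, so switching the digit of \<open>n\<close> there
  changes the sign of \<^term>\<open>walsh n (t i)\<close> and of no other \<^term>\<open>walsh n (t i')\<close>. Hence any pattern of signs is realised
  without touching the digits of \<open>n\<close> below \<open>b\<close>; the digit at \<open>b + M\<close> fixes the order of \<open>n\<close>.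
\<close>

lemma exists_index_with_walsh_signs:
  fixes \<sigma> :: "nat \<Rightarrow> real"
  assumes t: "\<And>i j. i < M \<Longrightarrow> b \<le> j \<Longrightarrow> j \<le> b + M \<Longrightarrow> digit j (t i) = of_bool (j = b + i)"
    and \<sigma>: "\<And>i. \<sigma> i = 1 \<or> \<sigma> i = -1"
  shows "\<exists>n. 0 < n \<and> order_of n = b + M \<and> (\<forall>k<b. eps k n = of_bool (d k)) \<and> (\<forall>i<M. walsh n (t i) = \<sigma> i)"
proof -
  define R where "R = Suc (b + M)"
  obtain n\<^sub>0 where n\<^sub>0: "\<And>k. eps k n\<^sub>0 = of_bool (k < R \<and> (if k < b then d k else k = b + M))"
    using exists_bits[of R "\<lambda>k. if k < b then d k else k = b + M"] by auto
  define flip where "flip i \<longleftrightarrow> walsh n\<^sub>0 (t i) \<noteq> \<sigma> i" for i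
  obtain n where n: "\<And>k. eps k n = of_bool (k < R \<and>
      (if k < b then d k else if k < b + M then flip (k - b) else k = b + M))"
    using exists_bits[of R "\<lambda>k. if k < b then d k else if k < b + M then flip (k - b) else k = b + M"]
    by auto
  have "order_of n = b + M"
    by (rule order_of_eqI) (auto simp: n R_def)
  moreover have "eps (b + M) n = 1" by (simp add: n R_def)
  then have "0 < n" by (cases n) (auto simp: eps_def)
  moreover have "walsh n (t i) = \<sigma> i" if i: "i < M" for i
  proof -
    have "rademacher k (t i) ^ eps k n
        = rademacher k (t i) ^ eps k n\<^sub>0 * (if k = b + i then (if flip i then - 1 else 1) else 1)"
      if k: "k < R" for k
      using k i t[OF i, of k] by (auto simp: n n\<^sub>0 rademacher_def R_def)
    then have "(\<Prod>k<R. rademacher k (t i) ^ eps k n)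
        = (\<Prod>k<R. rademacher k (t i) ^ eps k n\<^sub>0) *
          (\<Prod>k<R. if k = b + i then (if flip i then - 1 else 1) else 1)"
      unfolding prod.distrib[symmetric] by (intro prod.cong) auto
    also have "(\<Prod>k<R. if k = b + i then (if flip i then - 1 else 1) else 1) = (if flip i then - 1 else 1 :: real)"
      using i by (subst prod.delta) (auto simp: R_def)
    finally have "walsh n (t i) = walsh n\<^sub>0 (t i) * (if flip i then - 1 else 1)"
      by (subst (1 2) walsh_eq_prod[of R]) (auto simp: n n\<^sub>0)
    moreover have "walsh n\<^sub>0 (t i) = 1 \<or> walsh n\<^sub>0 (t i) = - 1"
      using abs_walsh[of n\<^sub>0 "t i"] by linarith
    ultimately show ?thesis
      using \<sigma>[of i] by (auto simp: flip_def)
  qed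
  moreover have "\<forall>k<b. eps k n = of_bool (d k)" by (simp add: n R_def)
  ultimately show ?thesis by blast
qed

section \<open>Divergence\<close>

lemma measurable_W_C [measurable]: "W_C \<Omega> f \<in> borel_measurable unit_interval"
proof -
  have "weighted_sum \<Omega> n f \<in> borel_measurable unit_interval" for n
  proof -
    have "weighted_sum \<Omega> n f = (\<lambda>x. \<Sum>k<Suc (order_of n).
        real (eps k n) * \<Omega> k n * E_diff k (\<lambda>y. f y * walsh n y) x)"
      by (rule ext, rule weighted_sum_eq_sum) (simp add: eps_above_order)
    then show ?thesis
      unfolding E_diff_def by simp
  qed
  then show ?thesis
    unfolding W_C_def by measurable
qed

text \<open>
  The test function consists of \<open>M = 2 ^ L\<close> equal masses at points \<open>t i\<close> of \<open>[0, 2 ^ (- a))\<close>. From position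
  \<open>a\<close> on, the digits of \<open>t i\<close> are the word \<open>i\<close> of length \<open>L\<close>, one \<open>0\<close>, and a block in which only the
  \<open>i\<close>-th digit is \<open>1\<close>, which makes the signs of the Walsh functions independent. The points \<open>u i\<close> have
  the digit \<open>1\<close> in place of that \<open>0\<close>; hence every \<open>x\<close> near \<open>u i\<close> first differs from every \<open>t i'\<close> at one of the
  positions \<open>a\<close> to \<open>a + L\<close>, where the digits of the index alternate and the kernel has a known sign.
  Choosing the Walsh signs to match makes all contributions positive, and they add up to at least
  \<open>c * 2 ^ a * (L + 1) / 4\<close> on the union of the cylinders around the \<open>u i\<close>, a set of measure
  \<open>2 ^ (- a) / 2\<close>. The factor \<open>2 ^ a\<close> cancels, so \<open>a\<close> may depend on \<open>L\<close>.
\<close>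

lemma weak_type_norm_lower_bound:
  assumes w: "weights \<Omega>" and c: "0 < c" and a: "1 \<le> a" and L: "1 \<le> L"
    and \<Omega>: "\<And>n. 0 < n \<Longrightarrow> order_of n = a + L + 1 + 2 ^ L \<Longrightarrow> c \<le> \<Omega> a n"
  shows "ennreal (c * real L / 8) \<le> weak_type_norm (W_C \<Omega>)"
proof -
  define M :: nat where "M = 2 ^ L"
  define b where "b = a + L + 1"
  define R where "R = Suc (b + M)"
  let ?prefix = "\<lambda>i j. a \<le> j \<and> j < a + L \<and> bit i (j - a)"
  have "\<exists>t. \<forall>i. t i \<in> {0..<1} \<and> (\<forall>j<R. digit j (t i) = of_bool (?prefix i j \<or> j = b + i))"
    by (intro choice allI exists_digits)
  then obtain t :: "nat \<Rightarrow> real" where t: "\<And>i. t i \<in> {0..<1}"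
    and digit_t: "\<And>i j. j < R \<Longrightarrow> digit j (t i) = of_bool (?prefix i j \<or> j = b + i)"
    by blast
  have "\<exists>u. \<forall>i. u i \<in> {0..<1} \<and> (\<forall>j<b. digit j (u i) = of_bool (?prefix i j \<or> j = a + L))"
    by (intro choice allI exists_digits)
  then obtain u :: "nat \<Rightarrow> real" where u: "\<And>i. u i \<in> {0..<1}"
    and digit_u: "\<And>i j. j < b \<Longrightarrow> digit j (u i) = of_bool (?prefix i j \<or> j = a + L)"
    by blast
  define f where "f = point_masses (1 / M) R {..<M} t"
  define X where "X = (\<Union>i<M. cylinder b (u i))"
  \<comment> \<open>with \<open>L\<close> in place of \<open>L + 1\<close>, because the level sets are strict\<close>
  define \<theta> where "\<theta> = c * 2 ^ a * real L / 4"
  have \<theta>: "0 < \<theta>" using c L by (simp add: \<theta>_def)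
  have X: "X \<in> sets unit_interval"
    unfolding X_def using u by (intro sets.finite_UN) auto
  have measure_X: "measure unit_interval X = 1 / (2 * 2 ^ a)"
  proof -
    have "disjoint_family_on (\<lambda>i. cylinder b (u i)) {..<M}"
      unfolding disjoint_family_on_def
    proof (intro ballI impI, rule ccontr)
      fix i i' assume i: "i \<in> {..<M}" "i' \<in> {..<M}" "i \<noteq> i'"
        and "cylinder b (u i) \<inter> cylinder b (u i') \<noteq> {}"
      then have eq: "digit j (u i) = digit j (u i')" if "j < b" for j
        using that by (auto simp: cylinder_def)
      have "bit i l = bit i' l" if "l < L" for l
        using eq[of "a + l"] that by (simp add: digit_u b_def of_bool_eq_iff)
      then show False
        using nat_eq_of_low_bits[of i L i'] i by (auto simp: M_def)
    qed
    then have "measure unit_interval X = (\<Sum>i<M. measure unit_interval (cylinder b (u i)))"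
      unfolding X_def using u by (intro unit.finite_measure_finite_Union) auto
    also have "\<dots> = 1 / (2 * 2 ^ a)"
      using u by (simp add: measure_cylinder M_def b_def power_add field_simps)
    finally show ?thesis .
  qed
  have "\<exists>n. \<forall>i. 0 < n i \<and> order_of (n i) = b + M \<and>
      (\<forall>k<b. eps k (n i) = of_bool (a \<le> k \<and> even (k - a))) \<and>
      (\<forall>i'<M. walsh (n i) (t i') = (if even (first_difference L i i') then - 1 else 1))"
    by (intro choice allI exists_index_with_walsh_signs) (auto simp: digit_t R_def b_def)
  then obtain n :: "nat \<Rightarrow> nat" where n_pos: "\<And>i. 0 < n i" and order_n: "\<And>i. order_of (n i) = b + M"
    and eps_n: "\<And>i k. k < b \<Longrightarrow> eps k (n i) = of_bool (a \<le> k \<and> even (k - a))"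
    and walsh_n: "\<And>i i'. i' < M \<Longrightarrow> walsh (n i) (t i') = (if even (first_difference L i i') then - 1 else 1)"
    by blast
  have above: "eps k (n i) = 0" if "R \<le> k" for i k
    using that order_n[of i] by (intro eps_above_order) (simp add: R_def)
  have large: "\<theta> < (\<Sum>i'<M. 1 / M * walsh (n i) (t i') * walsh_kernel \<Omega> (n i) (a + first_difference L i i'))" for i
  proof -
    have "\<theta> < c * 2 ^ a / (4 * M) * (real (Suc L) * 2 ^ L)"
      using c by (simp add: \<theta>_def M_def field_simps)
    also have "\<dots> \<le> c * 2 ^ a / (4 * M) * (\<Sum>i'<2 ^ L. 2 * 2 ^ first_difference L i i')"
      using c by (intro mult_left_mono sum_first_difference) auto
    also have "\<dots> = (\<Sum>i'<M. 1 / M * (c * 2 ^ (a + first_difference L i i') / 2))"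
      unfolding sum_distrib_left M_def by (intro sum.cong refl) (simp add: power_add)
    also have "\<dots> \<le> (\<Sum>i'<M. 1 / M * walsh (n i) (t i') * walsh_kernel \<Omega> (n i) (a + first_difference L i i'))"
    proof (rule sum_mono)
      fix i' assume i': "i' \<in> {..<M}"
      let ?l = "first_difference L i i'"
      have "c * 2 ^ (a + ?l) \<le> 2 * ((if even ?l then - 1 else 1) * walsh_kernel \<Omega> (n i) (a + ?l))"
      proof (rule walsh_kernel_sign[where L = L, OF w c _ a])
        show "c \<le> \<Omega> a (n i)"
          using n_pos order_n by (intro \<Omega>) (simp_all add: b_def M_def)
      qed (use first_difference_le in \<open>auto simp: eps_n b_def\<close>)
      then have "c * 2 ^ (a + ?l) / 2 \<le> walsh (n i) (t i') * walsh_kernel \<Omega> (n i) (a + ?l)"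
        using i' by (simp only: walsh_n lessThan_iff)
      then show "1 / M * (c * 2 ^ (a + ?l) / 2)
          \<le> 1 / M * walsh (n i) (t i') * walsh_kernel \<Omega> (n i) (a + ?l)"
        unfolding mult.assoc by (intro mult_left_mono) auto
    qed
    finally show ?thesis .
  qed
  have f: "integrable unit_interval f" "(\<integral>x. \<bar>f x\<bar> \<partial>unit_interval) \<le> 1"
    unfolding f_def using t by (auto simp: integrable_point_masses norm_point_masses M_def)
  let ?S = "{x \<in> {0..<1}. ennreal \<theta> < W_C \<Omega> f x}"
  have S: "?S \<in> sets unit_interval"
  proof -
    have "{x \<in> space unit_interval. ennreal \<theta> < W_C \<Omega> f x} \<in> sets unit_interval" by measurable
    then show ?thesis by simp
  qed
  have AE: "AE x in unit_interval. \<forall>i. \<forall>J. (\<forall>i'\<in>{..<M}. J i' < R \<and> (\<forall>j<J i'. digit j x = digit j (t i')) \<and>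
        digit (J i') x \<noteq> digit (J i') (t i')) \<longrightarrow>
      weighted_sum \<Omega> (n i) f x = (\<Sum>i'<M. 1 / M * walsh (n i) (t i') * walsh_kernel \<Omega> (n i) (J i'))"
    unfolding AE_all_countable f_def by (intro allI weighted_sum_point_masses t above)
  have "emeasure unit_interval X \<le> emeasure unit_interval ?S"
  proof (rule emeasure_mono_AE[OF _ S])
    show "AE x in unit_interval. x \<in> X \<longrightarrow> x \<in> ?S"
      using AE
    proof eventually_elim
      case (elim x)
      show ?case
      proof
        assume "x \<in> X"
        then obtain i where i: "i < M" and x: "x \<in> cylinder b (u i)" by (auto simp: X_def)
        have digit_x: "digit j x = of_bool (?prefix i j \<or> j = a + L)" if "j < b" for j
          using x that by (simp add: cylinder_def digit_u)
        have "weighted_sum \<Omega> (n i) f x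
            = (\<Sum>i'<M. 1 / M * walsh (n i) (t i') * walsh_kernel \<Omega> (n i) (a + first_difference L i i'))"
        proof (rule elim[rule_format], intro conjI allI impI)
          fix i' assume "i' \<in> {..<M}"
          let ?l = "first_difference L i i'"
          have l: "?l \<le> L" by (rule first_difference_le)
          show "a + ?l < R" using l by (simp add: R_def b_def)
          show "digit j x = digit j (t i')" if j: "j < a + ?l" for j
          proof (cases "a \<le> j")
            case True
            then have "bit i (j - a) = bit i' (j - a)"
              using j by (intro bit_eq_below_first_difference[of _ L]) simp
            then show ?thesis using j l by (simp add: digit_x digit_t b_def R_def)
          next
            case False
            then show ?thesis by (simp add: digit_x digit_t b_def R_def)
          qed
          show "digit (a + ?l) x \<noteq> digit (a + ?l) (t i')"
            using l bit_neq_at_first_difference[of L i i']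
            by (cases "?l = L") (auto simp: digit_x digit_t b_def R_def)
        qed
        then have "\<theta> < \<bar>weighted_sum \<Omega> (n i) f x\<bar>"
          using large[of i] by linarith
        then have "ennreal \<theta> < ennreal \<bar>weighted_sum \<Omega> (n i) f x\<bar>"
          using \<theta> by (simp add: ennreal_less_iff)
        also have "\<dots> \<le> W_C \<Omega> f x"
          unfolding W_C_def by (rule SUP_upper) simp
        finally show "x \<in> ?S" using x by (simp add: cylinder_def)
      qed
    qed
  qed
  moreover have "emeasure unit_interval X = ennreal (1 / (2 * 2 ^ a))"
    by (simp only: unit.emeasure_eq_measure measure_X)
  moreover have "ennreal (c * real L / 8) = ennreal \<theta> * ennreal (1 / (2 * 2 ^ a))"
    using \<theta> by (simp add: \<theta>_def flip: ennreal_mult')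
  ultimately have "ennreal (c * real L / 8) \<le> ennreal \<theta> * emeasure unit_interval ?S"
    by (simp add: mult_left_mono)
  also have "\<dots> \<le> weak_L1_norm (W_C \<Omega> f)"
    unfolding weak_L1_norm_def using \<theta> by (intro SUP_upper) simp
  also have "\<dots> \<le> weak_type_norm (W_C \<Omega>)"
    unfolding weak_type_norm_def using f by (intro SUP_upper) simp
  finally show ?thesis .
qed

text \<open>
  Since \<open>\<gamma> n\<close> is at least any given \<open>G\<close> once \<open>n\<close> has large order, the \<open>G\<close> weights just below the top digit of
  \<open>n\<close> are bounded below by monotonicity, with a constant that does not depend on \<open>G\<close>.
\<close>

lemma divergence_sequence_large_weights:
  assumes w: "weights \<Omega>" and "divergence_sequence \<Omega> \<gamma>"
  shows "\<exists>c>0. \<forall>G. \<exists>a\<ge>1. \<forall>n. 0 < n \<longrightarrow> order_of n = a + G \<longrightarrow> c \<le> \<Omega> a n"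
proof -
  obtain N0 c where lim: "filterlim (\<lambda>N. INF n\<in>{n. 0 < n \<and> N \<le> order_of n}. \<gamma> n) at_top sequentially"
    and c: "0 < c" and \<Omega>: "\<And>n. 0 < n \<Longrightarrow> N0 \<le> order_of n \<Longrightarrow> c \<le> \<Omega> (order_of n - \<gamma> n) n"
    using assms(2) unfolding divergence_sequence_def by blast
  have "\<exists>a\<ge>1. \<forall>n. 0 < n \<longrightarrow> order_of n = a + G \<longrightarrow> c \<le> \<Omega> a n" for G
  proof -
    obtain N1 where N1: "\<And>N. N1 \<le> N \<Longrightarrow> G \<le> (INF n\<in>{n. 0 < n \<and> N \<le> order_of n}. \<gamma> n)"
      using lim unfolding filterlim_at_top eventually_sequentially by meson
    define a where "a = N1 + N0 + 1"
    have "c \<le> \<Omega> a n" if n: "0 < n" "order_of n = a + G" for n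
    proof -
      have "G \<le> (INF n\<in>{n. 0 < n \<and> a + G \<le> order_of n}. \<gamma> n)"
        by (rule N1) (simp add: a_def)
      also have "\<dots> \<le> \<gamma> n"
        using n by (intro cINF_lower) auto
      finally have "order_of n - \<gamma> n \<le> a" using n(2) by simp
      then have "\<Omega> (order_of n - \<gamma> n) n \<le> \<Omega> a n" by (rule weights_mono[OF w])
      moreover have "c \<le> \<Omega> (order_of n - \<gamma> n) n"
        using n by (intro \<Omega>) (simp_all add: a_def)
      ultimately show ?thesis by linarith
    qed
    then show ?thesis by (intro exI[of _ a]) (simp add: a_def)
  qed
  with c show ?thesis by blast
qed

lemma divergence_not_weak_type:
  assumes w: "weights \<Omega>" and "divergence_sequence \<Omega> \<gamma>"
  shows "weak_type_norm (W_C \<Omega>) = \<infinity>"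
proof -
  obtain c where c: "0 < c"
    and large: "\<And>G. \<exists>a\<ge>1. \<forall>n. 0 < n \<longrightarrow> order_of n = a + G \<longrightarrow> c \<le> \<Omega> a n"
    using divergence_sequence_large_weights[OF assms] by auto
  have bound: "ennreal (c * real L / 8) \<le> weak_type_norm (W_C \<Omega>)" if L: "1 \<le> L" for L
  proof -
    obtain a where a: "1 \<le> a" "\<And>n. 0 < n \<Longrightarrow> order_of n = a + (L + 1 + 2 ^ L) \<Longrightarrow> c \<le> \<Omega> a n"
      using large[of "L + 1 + 2 ^ L"] by blast
    show ?thesis
      by (rule weak_type_norm_lower_bound[OF w c a(1) L]) (simp add: a(2))
  qed
  show ?thesis
  proof (rule ccontr)
    assume "weak_type_norm (W_C \<Omega>) \<noteq> \<infinity>"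
    then obtain r where r: "0 \<le> r" "weak_type_norm (W_C \<Omega>) = ennreal r"
      by (cases "weak_type_norm (W_C \<Omega>)") auto
    obtain L where L: "8 * r / c < real L" using reals_Archimedean2 by blast
    then have "1 \<le> L" using r(1) c by (cases L) (auto simp: field_simps)
    then have "c * real L / 8 \<le> r"
      using bound[of L] r by simp
    then show False using L c by (simp add: field_simps)
  qed
qed

theorem theorem1:
  fixes \<Omega> :: "nat \<Rightarrow> nat \<Rightarrow> real" and ns :: "nat \<Rightarrow> nat"
  assumes "weights \<Omega>"
    and "\<And>a. 0 < ns a"
  shows "((SUP a. ereal (\<Sum>k=0..order_of (ns a).
              \<bar>(if k = 0 then 0 else real (eps (k - 1) (ns a))) - real (eps k (ns a))\<bar>
                * \<Omega> k (ns a))) < \<infinity>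
            \<longrightarrow> (SUP a. ereal (\<Omega> (order_of (ns a)) (ns a))) < \<infinity>
            \<longrightarrow> weak_type_norm (W_C_seq \<Omega> ns) < \<infinity>)
       \<and> ((\<exists>\<gamma>. divergence_sequence \<Omega> \<gamma>) \<longrightarrow> weak_type_norm (W_C \<Omega>) = \<infinity>)"
  using bounded_variation_weak_type[OF assms(1), of ns] divergence_not_weak_type[OF assms(1)]
  unfolding digit_variation_def by blast

end
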